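(* Let $b\in\{0,1\}$, let $G$ be a graph of genus $g$ and let $S\subset E(G)$. Consider the map $\overline{\mathcal{OP}}^b_G\to\mathbb Z^{V(G)}$, $\overline O_S\mapsto\underline d^{O_S}$. (a) This map induces a bijection between $\overline{\mathcal O}^b(G-S)$ and $\Sigma^b(G-S)$. (b) If $O_S$ is a $b$-orientation on $G-S$ with $\underline d^{O_S}\in\Sigma^b(G-S)$, then $O_S\in\mathcal O^b(G-S)$.
   Context: **Graphs.** A graph $G$ is finite, with vertex set $V$, edge set $E$, weight function $w:V\to\mathbb N$; loops and multiple edges are allowed; each edge consists of two half-edges with ends in $V$. The genus is $g(G)=\sum_v w(v)-|V|+|E|+c(G)$, with $c(G)$ the number of connected components. $G-S$ is $G$ with the edges of $S$ deleted (same vertices). $G[Z]$ is the induced subgraph, $g(Z)=g(G[Z])$. For $\emptyset\neq Z\subsetneq V$, the cut $E(Z,Z^c)$ is the set of edges joining $Z$ and $Z^c=V\setminus Z$; a bridge is an edge $e$ with $\{e\}$ a cut. **Orientations.** A generalized orientation assigns to each edge one direction or both (bioriented: both ends are sources and targets); a $b$-orientation has exactly $b$ bioriented edges. A $0$-orientation is totally cyclic if every nonempty cut $E(Z,Z^c)$ has an edge with target in $Z$ and one with target in $Z^c$. A $1$-orientation with bioriented edge $e$ is rooted if for every $Z\subsetneq V$ with $e\in G[Z]$ the cut $E(Z,Z^c)$ has an edge with target in $Z^c$. $\mathcal O^0(G)$, $\mathcal O^1(G)$: sets of totally cyclic $0$-orientations, resp. rooted $1$-orientations. If $G$ has no edges,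 $\mathcal O^0(G)$ consists of the empty orientation; if $G$ is a single vertex without edges, $\mathcal O^1(G)$ also consists of the empty orientation. For a $b$-orientation $O$ on $G$: $\underline d^O\in\mathbb Z^V$, $\underline d^O_v=w(v)-1+\underline t^O_v$ with $\underline t^O_v$ the number of half-edges with target $v$ if $E\ne\emptyset$, and $\underline d^O_v=w(v)-1+b$ if $E=\emptyset$. $O\sim O'$ iff $\underline d^O=\underline d^{O'}$; $\overline O$ is the class, $\overline{\mathcal O}^b(G)=\mathcal O^b(G)/\sim$. The subscript in $O_S$ means the orientation is on $G-S$. $\overline{\mathcal{OP}}^b_G=\bigsqcup_{S}\overline{\mathcal O}^b(G-S)$, over the $S\subset E$ with $G-S$ bridgeless if $b=0$, connected if $b=1$. **Stable divisors.** For $\underline d\in\mathbb Z^V$, $|\underline d|=\sum_v\underline d_v$, $|\underline d_Z|=\sum_{v\in Z}\underline d_v$. For a graph $\Gamma$: $\Sigma^1(\Gamma)$ is the set of $\underline d\in\mathbb Z^{V(\Gamma)}$ with $|\underline d|=g(\Gamma)$ and $|\underline d_Z|>g(Z)-1$ for all nonempty $Z\subset V(\Gamma)$ if $\Gamma$ is connected, and is empty if $\Gamma$ is not connected. If $\Gamma$ is connected, $\Sigma^0(\Gamma)$ is the set of $\underline d$ with $|\underline d|=g(\Gamma)-1$ and $|\underline d_Z|>g(Z)-1$ for all $\emptyset\neq Z\subsetneq V(\Gamma)$; in general $\Sigma^0(\Gamma)$ is the set of $\underline d$ whose restriction to every connected component $\Gamma_i$ lies in $\Sigma^0(\Gamma_i)$.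 *)

theory Defs
  imports Main "HOL-Library.FuncSet"
begin

(* The two half-edges of an edge e are (e, False) and (e, True); half_end gives
   the vertex at which a half-edge ends. Loops and multiple edges are allowed. *)
record ('v, 'e) wgraph =
  verts :: "'v set"
  edges :: "'e set"
  half_end :: "'e \<times> bool \<Rightarrow> 'v"
  weight :: "'v \<Rightarrow> nat"

definition half_edges :: "('v, 'e) wgraph \<Rightarrow> ('e \<times> bool) set" where
  "half_edges G = edges G \<times> UNIV"

definition weighted_graph :: "('v, 'e) wgraph \<Rightarrow> bool" where
  "weighted_graph G \<longleftrightarrow> finite (verts G) \<and> finite (edges G) \<and>
     (\<forall>h \<in> half_edges G. half_end G h \<in> verts G)"

definition reachable :: "('v, 'e) wgraph \<Rightarrow> ('v \<times> 'v) set" where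
  "reachable G = {(u, v). u \<in> verts G \<and> v \<in> verts G \<and>
     (u, v) \<in> {(half_end G (e, i), half_end G (e, \<not> i)) | e i. e \<in> edges G}\<^sup>*}"

definition components :: "('v, 'e) wgraph \<Rightarrow> 'v set set" where
  "components G = verts G // reachable G"

(* The graph without vertices is not connected. *)
definition connected_graph :: "('v, 'e) wgraph \<Rightarrow> bool" where
  "connected_graph G \<longleftrightarrow> verts G \<noteq> {} \<and>
     (\<forall>u \<in> verts G. \<forall>v \<in> verts G. (u, v) \<in> reachable G)"

definition genus :: "('v, 'e) wgraph \<Rightarrow> int" where
  "genus G = (\<Sum>v \<in> verts G. int (weight G v)) - int (card (verts G))
     + int (card (edges G)) + int (card (components G))"

definition del_edges :: "('v, 'e) wgraph \<Rightarrow> 'e set \<Rightarrow> ('v, 'e) wgraph" where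
  "del_edges G S = G\<lparr>edges := edges G - S\<rparr>"

definition induced :: "('v, 'e) wgraph \<Rightarrow> 'v set \<Rightarrow> ('v, 'e) wgraph" where
  "induced G Z = G\<lparr>verts := Z, edges := {e \<in> edges G. \<forall>i. half_end G (e, i) \<in> Z}\<rparr>"

definition cut :: "('v, 'e) wgraph \<Rightarrow> 'v set \<Rightarrow> 'e set" where
  "cut G Z = {e \<in> edges G. \<exists>i. half_end G (e, i) \<in> Z \<and>
     half_end G (e, \<not> i) \<in> verts G - Z}"

definition bridge :: "('v, 'e) wgraph \<Rightarrow> 'e \<Rightarrow> bool" where
  "bridge G e \<longleftrightarrow> (\<exists>Z. Z \<noteq> {} \<and> Z \<subset> verts G \<and> cut G Z = {e})"

definition bridgeless :: "('v, 'e) wgraph \<Rightarrow> bool" where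
  "bridgeless G \<longleftrightarrow> (\<forall>e \<in> edges G. \<not> bridge G e)"

(* A generalized orientation is given by its set of target half-edges: exactly one
   half-edge of an edge with a single direction, both half-edges of a bioriented
   edge. In particular a loop has two distinct directions. *)
definition gen_orientation :: "('v, 'e) wgraph \<Rightarrow> ('e \<times> bool) set \<Rightarrow> bool" where
  "gen_orientation G T \<longleftrightarrow> T \<subseteq> half_edges G \<and> (\<forall>e \<in> edges G. \<exists>i. (e, i) \<in> T)"

definition bioriented :: "('v, 'e) wgraph \<Rightarrow> ('e \<times> bool) set \<Rightarrow> 'e set" where
  "bioriented G T = {e \<in> edges G. \<forall>i. (e, i) \<in> T}"

definition lone_vertex :: "('v, 'e) wgraph \<Rightarrow> bool" where
  "lone_vertex G \<longleftrightarrow> edges G = {} \<and> card (verts G) = 1"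

(* By convention the empty orientation of a single vertex without edges also counts
   as a 1-orientation. *)
definition b_orientation :: "nat \<Rightarrow> ('v, 'e) wgraph \<Rightarrow> ('e \<times> bool) set \<Rightarrow> bool" where
  "b_orientation b G T \<longleftrightarrow> gen_orientation G T \<and>
     (card (bioriented G T) = b \<or> (b = 1 \<and> lone_vertex G))"

definition has_target_in ::
  "('v, 'e) wgraph \<Rightarrow> ('e \<times> bool) set \<Rightarrow> 'e \<Rightarrow> 'v set \<Rightarrow> bool" where
  "has_target_in G T e Z \<longleftrightarrow> (\<exists>i. (e, i) \<in> T \<and> half_end G (e, i) \<in> Z)"

definition totally_cyclic :: "('v, 'e) wgraph \<Rightarrow> ('e \<times> bool) set \<Rightarrow> bool" where
  "totally_cyclic G T \<longleftrightarrow>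
     (\<forall>Z. Z \<noteq> {} \<and> Z \<subset> verts G \<and> cut G Z \<noteq> {} \<longrightarrow>
        (\<exists>e \<in> cut G Z. has_target_in G T e Z) \<and>
        (\<exists>e \<in> cut G Z. has_target_in G T e (verts G - Z)))"

definition rooted :: "('v, 'e) wgraph \<Rightarrow> ('e \<times> bool) set \<Rightarrow> bool" where
  "rooted G T \<longleftrightarrow>
     (\<exists>e. bioriented G T = {e} \<and>
        (\<forall>Z. Z \<subset> verts G \<and> e \<in> edges (induced G Z) \<longrightarrow>
           (\<exists>f \<in> cut G Z. has_target_in G T f (verts G - Z))))"

(* Only b = 0 and b = 1 are meaningful here and below. *)
definition orientations :: "nat \<Rightarrow> ('v, 'e) wgraph \<Rightarrow> ('e \<times> bool) set set" where
  "orientations b G =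
     (if b = 0 then {T. b_orientation 0 G T \<and> totally_cyclic G T}
      else {T. b_orientation 1 G T \<and> (rooted G T \<or> lone_vertex G)})"

lemma orientations_0_no_edges: "edges G = {} \<Longrightarrow> orientations 0 G = {{}}"
  by (auto simp: orientations_def b_orientation_def gen_orientation_def half_edges_def
      bioriented_def totally_cyclic_def cut_def)

lemma orientations_1_lone_vertex: "lone_vertex G \<Longrightarrow> orientations 1 G = {{}}"
  by (auto simp: orientations_def b_orientation_def gen_orientation_def half_edges_def
      lone_vertex_def)

(* Elements of the group of integer vectors indexed by the vertices are
   functions extensional on the vertex set. *)
definition divisors :: "('v, 'e) wgraph \<Rightarrow> ('v \<Rightarrow> int) set" where
  "divisors G = verts G \<rightarrow>\<^sub>E UNIV"

definition orientation_divisor ::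
  "nat \<Rightarrow> ('v, 'e) wgraph \<Rightarrow> ('e \<times> bool) set \<Rightarrow> 'v \<Rightarrow> int" where
  "orientation_divisor b G T = restrict (\<lambda>v. int (weight G v) - 1 +
     (if edges G = {} then int b else int (card {h \<in> T. half_end G h = v}))) (verts G)"

definition orientation_equiv ::
  "nat \<Rightarrow> ('v, 'e) wgraph \<Rightarrow> (('e \<times> bool) set \<times> ('e \<times> bool) set) set" where
  "orientation_equiv b G = {(T, T'). T \<in> orientations b G \<and> T' \<in> orientations b G \<and>
     orientation_divisor b G T = orientation_divisor b G T'}"

definition orientation_classes ::
  "nat \<Rightarrow> ('v, 'e) wgraph \<Rightarrow> ('e \<times> bool) set set set" where
  "orientation_classes b G = orientations b G // orientation_equiv b G"

(* The disjoint union over S of the orientation classes of G - S. *)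
definition OP_classes ::
  "nat \<Rightarrow> ('v, 'e) wgraph \<Rightarrow> ('e set \<times> ('e \<times> bool) set set) set" where
  "OP_classes b G =
     (SIGMA S : {S. S \<subseteq> edges G \<and>
         (if b = 0 then bridgeless (del_edges G S) else connected_graph (del_edges G S))}.
       orientation_classes b (del_edges G S))"

(* All members of a class have the same divisor, so the image is a singleton. *)
definition OP_divisor ::
  "nat \<Rightarrow> ('v, 'e) wgraph \<Rightarrow> 'e set \<times> ('e \<times> bool) set set \<Rightarrow> 'v \<Rightarrow> int" where
  "OP_divisor b G = (\<lambda>(S, C). the_elem (orientation_divisor b (del_edges G S) ` C))"

definition stable1 :: "('v, 'e) wgraph \<Rightarrow> ('v \<Rightarrow> int) set" where
  "stable1 G = (if connected_graph G then
     {d \<in> divisors G. (\<Sum>v \<in> verts G. d v) = genus G \<and>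
        (\<forall>Z. Z \<noteq> {} \<and> Z \<subseteq> verts G \<longrightarrow> (\<Sum>v \<in> Z. d v) > genus (induced G Z) - 1)}
     else {})"

definition stable0_connected :: "('v, 'e) wgraph \<Rightarrow> ('v \<Rightarrow> int) set" where
  "stable0_connected G =
     {d \<in> divisors G. (\<Sum>v \<in> verts G. d v) = genus G - 1 \<and>
        (\<forall>Z. Z \<noteq> {} \<and> Z \<subset> verts G \<longrightarrow> (\<Sum>v \<in> Z. d v) > genus (induced G Z) - 1)}"

(* For connected G the only component is verts G and this is stable0_connected G. *)
definition stable0 :: "('v, 'e) wgraph \<Rightarrow> ('v \<Rightarrow> int) set" where
  "stable0 G = {d \<in> divisors G.
     \<forall>Z \<in> components G. restrict d Z \<in> stable0_connected (induced G Z)}"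

definition stable_divisors :: "nat \<Rightarrow> ('v, 'e) wgraph \<Rightarrow> ('v \<Rightarrow> int) set" where
  "stable_divisors b G = (if b = 0 then stable0 G else stable1 G)"

end

theory Submission
  imports Defs
begin

text \<open>Put t = d - w + 1 and consider the surplus p(Z) = t(Z) - |E(G[Z])|. It is additive over
  connected components, so the condition |d_Z| > g(Z) - 1, which says that p(Z) is at least the
  number of components of G[Z], can be tested as p(Z) > 0. If t counts the targets of an
  orientation, then p(Z) is the number of edges of the cut of Z with target in Z, plus 1 if G[Z]
  contains the bioriented edge of a 1-orientation. This identifies stability of the divisor with total
  cyclicity, respectively rootedness. Every stable d is realised by Hakimi's theorem: indegrees t
  with p(V) = 0 and p nonnegative come from an orientation. For b = 1 it is applied after removing an
  arbitrary edge, which becomes the bioriented one.\<close>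

section \<open>Components and cuts\<close>

lemma del_edges_simps [simp]:
  "verts (del_edges G S) = verts G" "edges (del_edges G S) = edges G - S"
  "half_end (del_edges G S) = half_end G" "weight (del_edges G S) = weight G"
  by (simp_all add: del_edges_def)

lemma induced_simps [simp]:
  "verts (induced G Z) = Z"
  "edges (induced G Z) = {e \<in> edges G. \<forall>i. half_end G (e, i) \<in> Z}"
  "half_end (induced G Z) = half_end G" "weight (induced G Z) = weight G"
  by (simp_all add: induced_def)

lemma induced_induced: "Y \<subseteq> Z \<Longrightarrow> induced (induced G Z) Y = induced G Y"
  by (cases G) (auto simp: induced_def)

lemma finite_verts [simp]: "weighted_graph G \<Longrightarrow> finite (verts G)"
  and finite_edges [simp]: "weighted_graph G \<Longrightarrow> finite (edges G)"
  and half_end_in_verts: "weighted_graph G \<Longrightarrow> e \<in> edges G \<Longrightarrow> half_end G (e, i) \<in> verts G"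
  by (auto simp: weighted_graph_def half_edges_def)

lemma weighted_graph_del_edges: "weighted_graph G \<Longrightarrow> weighted_graph (del_edges G S)"
  unfolding weighted_graph_def by (auto simp: half_edges_def)

lemma weighted_graph_induced:
  "weighted_graph G \<Longrightarrow> Z \<subseteq> verts G \<Longrightarrow> weighted_graph (induced G Z)"
  unfolding weighted_graph_def by (auto simp: half_edges_def intro: finite_subset)

lemma equiv_reachable: "equiv (verts G) (reachable G)"
proof -
  define R where "R = {(half_end G (e, i), half_end G (e, \<not> i)) | e i. e \<in> edges G}"
  have reach: "(u, v) \<in> reachable G \<longleftrightarrow> u \<in> verts G \<and> v \<in> verts G \<and> (u, v) \<in> R\<^sup>*" for u v
    unfolding reachable_def R_def by blast
  have "(v, u) \<in> R" if uv: "(u, v) \<in> R" for u v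
  proof -
    obtain e i where "e \<in> edges G" "u = half_end G (e, i)" "v = half_end G (e, \<not> i)"
      using uv by (auto simp: R_def)
    \<comment> \<open>Reading the edge from its other half-edge reverses the pair.\<close>
    then show ?thesis
      unfolding R_def by (intro CollectI exI[of _ e] exI[of _ "\<not> i"]) simp
  qed
  then have "sym (R\<^sup>*)"
    by (intro sym_rtrancl symI)
  then have "sym (reachable G)"
    unfolding sym_def reach by blast
  moreover have "trans (reachable G)"
    unfolding trans_def reach by (blast intro: rtrancl_trans)
  moreover have "refl_on (verts G) (reachable G)"
    unfolding refl_on_def reach by blast
  moreover have "reachable G \<subseteq> verts G \<times> verts G"
    by (auto simp: reach)
  ultimately show ?thesis
    by (simp add: equiv_def)
qed

lemma reachable_edge:
  "weighted_graph G \<Longrightarrow> e \<in> edges G \<Longrightarrow> (half_end G (e, i), half_end G (e, j)) \<in> reachable G"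
  by (cases "i = j") (fastforce simp: reachable_def half_end_in_verts)+

text \<open>A path leaving \<open>Z\<close> would have to use an edge of the cut; the proof is an
  induction along the path.\<close>

lemma reachable_cut:
  assumes "(u, v) \<in> reachable G" "weighted_graph G" "cut G Z = {}" "u \<in> Z"
  shows "v \<in> Z"
proof -
  have "(u, v) \<in> {(half_end G (e, i), half_end G (e, \<not> i)) | e i. e \<in> edges G}\<^sup>*"
    using assms(1) by (simp add: reachable_def)
  then show ?thesis
  proof induction
    case base
    show ?case by fact
  next
    case (step y z)
    then show ?case
      using assms(2,3) half_end_in_verts unfolding cut_def by fastforce
  qed
qed

lemma cut_reachable_class:
  assumes "weighted_graph G"
  shows "cut G (reachable G `` {u}) = {}"
proof -
  have "\<And>e i. e \<in> edges G \<Longrightarrow> (u, half_end G (e, i)) \<in> reachable G \<Longrightarrow>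
      (u, half_end G (e, \<not> i)) \<in> reachable G"
    using reachable_edge[OF assms] equiv_reachable[of G] by (meson equivE transD)
  then show ?thesis
    by (auto simp: cut_def)
qed

text \<open>Orientations are tested on cuts, so connectedness is put in the same terms. A
  reachability class has empty cut, hence is everything once all proper nonempty cuts are
  nonempty.\<close>

lemma connected_graph_iff_cut:
  assumes "weighted_graph G"
  shows "connected_graph G \<longleftrightarrow>
    verts G \<noteq> {} \<and> (\<forall>Z. Z \<noteq> {} \<and> Z \<subset> verts G \<longrightarrow> cut G Z \<noteq> {})"
proof
  assume "connected_graph G"
  then show "verts G \<noteq> {} \<and> (\<forall>Z. Z \<noteq> {} \<and> Z \<subset> verts G \<longrightarrow> cut G Z \<noteq> {})"
    unfolding connected_graph_def using reachable_cut[OF _ assms] by blast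
next
  assume R: "verts G \<noteq> {} \<and> (\<forall>Z. Z \<noteq> {} \<and> Z \<subset> verts G \<longrightarrow> cut G Z \<noteq> {})"
  have "reachable G `` {u} = verts G" if "u \<in> verts G" for u
  proof -
    have "reachable G `` {u} \<noteq> {}" "reachable G `` {u} \<subseteq> verts G"
      using that by (auto simp: reachable_def)
    then show ?thesis
      using R cut_reachable_class[OF assms] by blast
  qed
  then show "connected_graph G"
    using R unfolding connected_graph_def by blast
qed

lemma component_facts:
  assumes "weighted_graph G" "C \<in> components G"
  shows component_nonempty: "C \<noteq> {}"
    and component_subset: "C \<subseteq> verts G"
    and cut_component: "cut G C = {}"
proof -
  obtain u where u: "u \<in> verts G" "C = reachable G `` {u}"
    using assms(2) unfolding components_def by (auto elim: quotientE)
  then show "cut G C = {}"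
    using cut_reachable_class[OF assms(1)] by simp
  show "C \<noteq> {}" "C \<subseteq> verts G"
    using u by (auto simp: reachable_def)
qed

text \<open>A point of \<open>Z\<close> and a point of \<open>C\<close> outside \<open>Z\<close> are
  joined by a path, which must cross the cut.\<close>

lemma cut_subset_component:
  assumes "weighted_graph G" "C \<in> components G" "Z \<noteq> {}" "Z \<subset> C"
  shows "cut G Z \<noteq> {}"
proof
  assume "cut G Z = {}"
  obtain u where "u \<in> verts G" "C = reachable G `` {u}"
    using assms(2) unfolding components_def by (auto elim: quotientE)
  obtain x y where "x \<in> Z" "y \<in> C" "y \<notin> Z"
    using assms by blast
  have "(x, y) \<in> reachable G"
    using \<open>C = _\<close> \<open>x \<in> Z\<close> \<open>y \<in> C\<close> assms(4) equiv_reachable[of G]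
    by (metis Image_singleton_iff equivE psubsetD symD transD)
  then show False
    using reachable_cut[OF _ assms(1) \<open>cut G Z = {}\<close> \<open>x \<in> Z\<close>] \<open>y \<notin> Z\<close> by blast
qed

text \<open>No edge leaves \<open>C\<close>, so proper subsets of \<open>C\<close> have the same cut
  in the induced graph as in \<open>G\<close>.\<close>

lemma connected_induced_component:
  assumes "weighted_graph G" "C \<in> components G"
  shows "connected_graph (induced G C)"
proof -
  have "cut (induced G C) Z = cut G Z" if "Z \<subset> C" for Z
  proof -
    have "e \<in> cut (induced G C) Z" if e: "e \<in> cut G Z" for e
    proof -
      obtain i where i: "e \<in> edges G" "half_end G (e, i) \<in> Z" "half_end G (e, \<not> i) \<in> verts G - Z"
        using e by (auto simp: cut_def)
      then have "half_end G (e, i) \<in> C" "half_end G (e, \<not> i) \<in> C"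
        using cut_component[OF assms] \<open>Z \<subset> C\<close> by (auto simp: cut_def)
      then have "half_end G (e, j) \<in> C" for j
        by (cases i; cases j) auto
      then show ?thesis
        using i by (auto simp: cut_def)
    qed
    then show ?thesis
      using component_subset[OF assms] by (auto simp: cut_def)
  qed
  then show ?thesis
    using connected_graph_iff_cut[OF weighted_graph_induced[OF assms(1) component_subset[OF assms]]]
      component_nonempty[OF assms] cut_subset_component[OF assms] by auto
qed

lemma finite_components: "weighted_graph G \<Longrightarrow> finite (components G)"
  unfolding components_def by (auto simp: quotient_def)

lemma Union_components: "\<Union>(components G) = verts G"
  unfolding components_def by (rule Union_quotient[OF equiv_reachable])

lemma components_disjoint:
  "C \<in> components G \<Longrightarrow> D \<in> components G \<Longrightarrow> C \<noteq> D \<Longrightarrow> C \<inter> D = {}"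
  unfolding components_def using quotient_disj[OF equiv_reachable] by blast

lemma card_components_pos: "weighted_graph G \<Longrightarrow> verts G \<noteq> {} \<Longrightarrow> 0 < card (components G)"
  using finite_components[of G] Union_components[of G] by (auto simp: card_gt_0_iff)

lemma card_components_connected:
  assumes "weighted_graph G" "connected_graph G"
  shows "card (components G) = 1"
proof -
  have "C = verts G" if "C \<in> components G" for C
    using component_facts[OF assms(1) that] assms connected_graph_iff_cut by blast
  then have "components G \<subseteq> {verts G}"
    by blast
  moreover have "components G \<noteq> {}"
    using Union_components[of G] assms(2) by (auto simp: connected_graph_def)
  ultimately have "components G = {verts G}"
    by blast
  then show ?thesis
    by simp
qed

lemma cut_empty_edge:
  assumes "weighted_graph G" "cut G Z = {}" "e \<in> edges G" "half_end G (e, i) \<in> Z"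
  shows "half_end G (e, j) \<in> Z"
proof (cases "j = i")
  case False
  then have "j = (\<not> i)" by auto
  then show ?thesis
    using assms(2-4) half_end_in_verts[OF assms(1,3)] by (auto simp: cut_def)
qed (use assms in simp)

section \<open>The surplus of a vertex set\<close>

text \<open>The function \<open>t\<close> is arbitrary, so that the same quantity serves for degrees
  shifted by the weights, for indegrees of an orientation, and for the indegrees still to be
  realised after an edge has been deleted.\<close>

definition surplus :: "('v, 'e) wgraph \<Rightarrow> ('v \<Rightarrow> int) \<Rightarrow> 'v set \<Rightarrow> int" where
  "surplus G t Z = (\<Sum>v \<in> Z. t v) - int (card (edges (induced G Z)))"

lemma surplus_empty [simp]: "surplus G t {} = 0"
  by (simp add: surplus_def)

lemma surplus_cong: "(\<And>v. v \<in> Z \<Longrightarrow> t v = t' v) \<Longrightarrow> surplus G t Z = surplus G t' Z"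
  by (simp add: surplus_def)

lemma surplus_induced: "Y \<subseteq> Z \<Longrightarrow> surplus (induced G Z) t Y = surplus G t Y"
  by (simp add: surplus_def induced_induced del: induced_simps)

text \<open>Vertices and edges of the subgraph induced on \<open>Z\<close> both split along the
  components, since both ends of an edge lie in the same one.\<close>

lemma surplus_components:
  assumes G: "weighted_graph G" and Z: "Z \<subseteq> verts G"
  shows "surplus G t Z = (\<Sum>C \<in> components G. surplus G t (Z \<inter> C))"
proof -
  have fin: "finite Z"
    using G Z finite_subset finite_verts by blast
  have "Z = (\<Union>C \<in> components G. Z \<inter> C)"
    using Z Union_components[of G] by blast
  then have "(\<Sum>v \<in> Z. t v) = (\<Sum>v \<in> (\<Union>C \<in> components G. Z \<inter> C). t v)"
    by simp
  also have "\<dots> = (\<Sum>C \<in> components G. \<Sum>v \<in> Z \<inter> C. t v)"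
    using fin components_disjoint[of _ G]
    by (intro sum.UNION_disjoint) (auto simp: finite_components[OF G])
  finally have sum: "(\<Sum>v \<in> Z. t v) = (\<Sum>C \<in> components G. \<Sum>v \<in> Z \<inter> C. t v)" .
  have "edges (induced G Z) = (\<Union>C \<in> components G. edges (induced G (Z \<inter> C)))"
  proof (intro equalityI subsetI)
    fix e assume e: "e \<in> edges (induced G Z)"
    then have "half_end G (e, True) \<in> \<Union>(components G)"
      using Z unfolding Union_components by auto
    then obtain C where C: "C \<in> components G" "half_end G (e, True) \<in> C"
      by blast
    have "half_end G (e, j) \<in> C" for j
      using cut_empty_edge[OF G cut_component[OF G C(1)] _ C(2)] e by simp
    then have "e \<in> edges (induced G (Z \<inter> C))"
      using e by simp
    with \<open>C \<in> _\<close> show "e \<in> (\<Union>C \<in> components G. edges (induced G (Z \<inter> C)))"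
      by blast
  qed auto
  moreover have "edges (induced G (Z \<inter> C)) \<inter> edges (induced G (Z \<inter> D)) = {}"
    if "C \<in> components G" "D \<in> components G" "C \<noteq> D" for C D
    using components_disjoint[OF that] by auto
  ultimately have "card (edges (induced G Z)) = (\<Sum>C \<in> components G. card (edges (induced G (Z \<inter> C))))"
    using card_UN_disjoint[of "components G" "\<lambda>C. edges (induced G (Z \<inter> C))"] finite_components[OF G] G
    by simp
  then show ?thesis
    by (simp add: surplus_def sum sum_subtractf)
qed

text \<open>An edge avoiding the cut lies entirely on one side of it.\<close>

lemma surplus_complement:
  assumes "weighted_graph G" "Z \<subseteq> verts G" "cut G Z = {}"
  shows "surplus G t (verts G) = surplus G t Z + surplus G t (verts G - Z)"
proof -
  have "(\<Sum>v \<in> verts G. t v) = (\<Sum>v \<in> Z. t v) + (\<Sum>v \<in> verts G - Z. t v)"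
    using sum.subset_diff[OF assms(2), of t] assms(1) by simp
  moreover have "edges (induced G (verts G)) = edges (induced G Z) \<union> edges (induced G (verts G - Z))"
  proof (intro equalityI subsetI)
    fix e assume "e \<in> edges (induced G (verts G))"
    then have e: "e \<in> edges G" "\<And>i. half_end G (e, i) \<in> verts G"
      by simp_all
    show "e \<in> edges (induced G Z) \<union> edges (induced G (verts G - Z))"
    proof (cases "half_end G (e, True) \<in> Z")
      case True
      then have "half_end G (e, i) \<in> Z" for i
        by (rule cut_empty_edge[OF assms(1,3) e(1)])
      then show ?thesis using e by simp
    next
      case False
      then have "half_end G (e, i) \<notin> Z" for i
        using cut_empty_edge[OF assms(1,3) e(1)] by blast
      then show ?thesis using e by simp
    qed
  qed (use assms(2) in auto)
  moreover have "edges (induced G Z) \<inter> edges (induced G (verts G - Z)) = {}"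
    by auto
  ultimately show ?thesis
    using assms(1) by (simp add: surplus_def card_Un_disjoint)
qed

section \<open>Stability in terms of the surplus\<close>

definition target_degrees :: "('v, 'e) wgraph \<Rightarrow> ('v \<Rightarrow> int) \<Rightarrow> 'v \<Rightarrow> int" where
  "target_degrees G d v = d v - int (weight G v) + 1"

text \<open>The shift in \<open>target_degrees\<close> absorbs the weights and the number of
  vertices in the genus; only the edges and the components remain.\<close>

lemma sum_minus_genus:
  assumes "weighted_graph G" "Z \<subseteq> verts G"
  shows "(\<Sum>v \<in> Z. d v) - genus (induced G Z) =
    surplus G (target_degrees G d) Z - int (card (components (induced G Z)))"
  by (simp add: genus_def surplus_def target_degrees_def sum_subtractf sum.distrib)

lemma surplus_ge_components:
  assumes G: "weighted_graph G" and Z: "Z \<subseteq> verts G"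
    and "\<And>C. C \<in> components (induced G Z) \<Longrightarrow> 1 \<le> surplus G t C"
  shows "int (card (components (induced G Z))) \<le> surplus G t Z"
proof -
  note GZ = weighted_graph_induced[OF G Z]
  have sub: "Z \<inter> C = C" "C \<subseteq> Z" if "C \<in> components (induced G Z)" for C
    using component_subset[OF GZ that] by auto
  have "surplus G t Z = (\<Sum>C \<in> components (induced G Z). surplus (induced G Z) t (Z \<inter> C))"
    using surplus_components[OF GZ, of Z] by (simp add: surplus_induced)
  also have "\<dots> = (\<Sum>C \<in> components (induced G Z). surplus G t C)"
    by (rule sum.cong) (auto simp: surplus_induced sub)
  also have "\<dots> \<ge> (\<Sum>C \<in> components (induced G Z). 1)"
    by (rule sum_mono) (rule assms)
  finally show ?thesis by simp
qed

text \<open>Forwards, a nonempty set induces at least one component. Backwards, the bound is applied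
  to every component of the subgraph induced on \<open>Z\<close> and summed, which is why
  \<open>P\<close> must pass to subsets. The predicate \<open>P\<close> covers both uses: all
  subsets for b = 1, proper subsets for b = 0.\<close>

lemma surplus_ge_components_iff:
  assumes G: "weighted_graph G" and V: "\<And>Z. P Z \<Longrightarrow> Z \<subseteq> verts G"
    and P: "\<And>Y Z. P Z \<Longrightarrow> Y \<subseteq> Z \<Longrightarrow> P Y"
  shows "(\<forall>Z. Z \<noteq> {} \<and> P Z \<longrightarrow> genus (induced G Z) - 1 < (\<Sum>v \<in> Z. d v)) \<longleftrightarrow>
    (\<forall>Z. Z \<noteq> {} \<and> P Z \<longrightarrow> 1 \<le> surplus G (target_degrees G d) Z)" (is "?L = ?R")
proof
  assume L: ?L
  show ?R
  proof (intro allI impI)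
    fix Z assume Z: "Z \<noteq> {} \<and> P Z"
    note ZV = V[OF conjunct2[OF Z]]
    have "0 < card (components (induced G Z))"
      using card_components_pos[OF weighted_graph_induced[OF G ZV]] Z by simp
    moreover have "genus (induced G Z) - 1 < (\<Sum>v \<in> Z. d v)"
      using L Z by blast
    ultimately show "1 \<le> surplus G (target_degrees G d) Z"
      using sum_minus_genus[OF G ZV, of d] by linarith
  qed
next
  assume R: ?R
  show ?L
  proof (intro allI impI)
    fix Z assume Z: "Z \<noteq> {} \<and> P Z"
    note ZV = V[OF conjunct2[OF Z]]
    have "1 \<le> surplus G (target_degrees G d) C" if "C \<in> components (induced G Z)" for C
    proof -
      have "C \<noteq> {}" "C \<subseteq> Z"
        using component_facts[OF weighted_graph_induced[OF G ZV] that] by simp_all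
      then show ?thesis
        using R P Z by blast
    qed
    then have "int (card (components (induced G Z))) \<le> surplus G (target_degrees G d) Z"
      by (rule surplus_ge_components[OF G ZV])
    then show "genus (induced G Z) - 1 < (\<Sum>v \<in> Z. d v)"
      using sum_minus_genus[OF G ZV, of d] by linarith
  qed
qed

lemma induced_verts: "weighted_graph G \<Longrightarrow> edges (induced G (verts G)) = edges G"
  by (auto simp: half_end_in_verts)

lemma genus_connected:
  assumes "weighted_graph G" "connected_graph G"
  shows "(\<Sum>v \<in> verts G. d v) - genus G = surplus G (target_degrees G d) (verts G) - 1"
  using card_components_connected[OF assms]
  by (simp add: genus_def surplus_def target_degrees_def sum_subtractf sum.distrib
      induced_verts assms del: induced_simps)

lemma stable1_iff:
  assumes G: "weighted_graph G"
  shows "d \<in> stable1 G \<longleftrightarrow> d \<in> divisors G \<and> connected_graph G \<and>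
    surplus G (target_degrees G d) (verts G) = 1 \<and>
    (\<forall>Z. Z \<noteq> {} \<and> Z \<subseteq> verts G \<longrightarrow> 1 \<le> surplus G (target_degrees G d) Z)"
  using surplus_ge_components_iff[OF G, of "\<lambda>Z. Z \<subseteq> verts G" d] genus_connected[OF G, of d]
  by (auto simp: stable1_def)

lemma stable0_connected_iff:
  assumes G: "weighted_graph G" and "connected_graph G"
  shows "d \<in> stable0_connected G \<longleftrightarrow> d \<in> divisors G \<and>
    surplus G (target_degrees G d) (verts G) = 0 \<and>
    (\<forall>Z. Z \<noteq> {} \<and> Z \<subset> verts G \<longrightarrow> 1 \<le> surplus G (target_degrees G d) Z)"
  using surplus_ge_components_iff[OF G, of "\<lambda>Z. Z \<subset> verts G" d] genus_connected[OF assms, of d]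
  by (auto simp: stable0_connected_def)

text \<open>Subsets of \<open>C\<close> induce the same subgraph in either graph, and their surplus
  does not see the values of \<open>d\<close> outside \<open>C\<close>.\<close>

lemma stable0_component_iff:
  assumes G: "weighted_graph G" and C: "C \<in> components G"
  shows "restrict d C \<in> stable0_connected (induced G C) \<longleftrightarrow>
    surplus G (target_degrees G d) C = 0 \<and>
    (\<forall>Z. Z \<noteq> {} \<and> Z \<subset> C \<longrightarrow> 1 \<le> surplus G (target_degrees G d) Z)"
proof -
  have "surplus (induced G C) (target_degrees (induced G C) (restrict d C)) Z
      = surplus G (target_degrees G d) Z" if "Z \<subseteq> C" for Z
    using that by (auto simp: surplus_induced target_degrees_def intro!: surplus_cong)
  moreover have "restrict d C \<in> divisors (induced G C)"
    by (simp add: divisors_def)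
  ultimately show ?thesis
    using stable0_connected_iff[OF weighted_graph_induced[OF G component_subset[OF G C]]
        connected_induced_component[OF G C], of "restrict d C"]
    by (simp add: psubset_eq)
qed

text \<open>Removes the components from the definition of stability for b = 0: positivity is
  demanded exactly where the cut is nonempty, which matches the form of total cyclicity, and
  nonnegativity elsewhere is what Hakimi's theorem asks for.\<close>

lemma stable0_iff:
  assumes G: "weighted_graph G"
  defines "p \<equiv> surplus G \<circ> target_degrees G"
  shows "d \<in> stable0 G \<longleftrightarrow> d \<in> divisors G \<and> p d (verts G) = 0 \<and>
    (\<forall>Z \<subseteq> verts G. 0 \<le> p d Z \<and> (cut G Z \<noteq> {} \<longrightarrow> 1 \<le> p d Z))" (is "_ \<longleftrightarrow> _ \<and> ?R")
proof -
  let ?L = "\<forall>C \<in> components G. p d C = 0 \<and> (\<forall>Z. Z \<noteq> {} \<and> Z \<subset> C \<longrightarrow> 1 \<le> p d Z)"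
  have "?L \<longleftrightarrow> ?R"
  proof
    assume L: ?L
    then have L1: "1 \<le> p d Z" if "C \<in> components G" "Z \<noteq> {}" "Z \<subset> C" for C Z
      using that by simp
    have nonneg: "0 \<le> p d (Z \<inter> C)" if "C \<in> components G" for Z C
    proof -
      consider "Z \<inter> C = {}" | "Z \<inter> C = C" | "Z \<inter> C \<noteq> {}" "Z \<inter> C \<subset> C" by blast
      then show ?thesis
      proof cases
        case 1
        then show ?thesis by (simp add: p_def)
      next
        case 2
        then show ?thesis using L that by simp
      next
        case 3
        from L1[OF \<open>C \<in> components G\<close> this] show ?thesis by simp
      qed
    qed
    have sum: "p d Z = (\<Sum>C \<in> components G. p d (Z \<inter> C))" if "Z \<subseteq> verts G" for Z
      unfolding p_def using surplus_components[OF G that] by simp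
    have "p d (verts G) = (\<Sum>C \<in> components G. p d C)"
      unfolding sum[OF subset_refl]
      by (rule sum.cong) (use component_subset[OF G] in \<open>auto simp: Int_absorb1\<close>)
    then have "p d (verts G) = 0"
      using L by simp
    moreover have "0 \<le> p d Z" if "Z \<subseteq> verts G" for Z
      unfolding sum[OF that] by (rule sum_nonneg) (rule nonneg)
    \<comment> \<open>A cut edge lies in one component, which \<open>Z\<close> therefore meets in a
      proper nonempty subset. That summand is positive and the others are nonnegative.\<close>
    moreover have "1 \<le> p d Z" if Z: "Z \<subseteq> verts G" "cut G Z \<noteq> {}" for Z
    proof -
      obtain e i where e: "e \<in> edges G" "half_end G (e, i) \<in> Z" "half_end G (e, \<not> i) \<in> verts G - Z"
        using Z(2) by (auto simp: cut_def)
      then obtain C where C: "C \<in> components G" "half_end G (e, i) \<in> C"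
        using Z(1) Union_components[of G] by blast
      have "half_end G (e, \<not> i) \<in> C"
        using cut_empty_edge[OF G cut_component[OF G C(1)] e(1) C(2)] .
      then have "Z \<inter> C \<noteq> {}" "Z \<inter> C \<subset> C"
        using e C by auto
      then have "1 \<le> p d (Z \<inter> C)"
        by (rule L1[OF C(1)])
      also have "\<dots> \<le> (\<Sum>C \<in> components G. p d (Z \<inter> C))"
        using nonneg C(1) by (intro member_le_sum) (auto simp: finite_components[OF G])
      finally show ?thesis
        unfolding sum[OF Z(1)] .
    qed
    ultimately show ?R by blast
  next
    assume R: ?R
    show ?L
    proof (intro ballI conjI allI impI)
      fix C assume C: "C \<in> components G"
      \<comment> \<open>The cut of \<open>C\<close> is empty, so two nonnegative surpluses add up to
        zero and both vanish.\<close>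
      have "p d C + p d (verts G - C) = 0"
        using R surplus_complement[OF G component_subset[OF G C] cut_component[OF G C]]
        by (simp add: p_def)
      moreover have "0 \<le> p d C" "0 \<le> p d (verts G - C)"
        using R component_subset[OF G C] by auto
      ultimately show "p d C = 0" by simp
      fix Z assume "Z \<noteq> {} \<and> Z \<subset> C"
      then have "cut G Z \<noteq> {}" "Z \<subseteq> verts G"
        using cut_subset_component[OF G C] component_subset[OF G C] by auto
      then show "1 \<le> p d Z"
        using R by simp
    qed
  qed
  then show ?thesis
    by (simp add: stable0_def stable0_component_iff[OF G] p_def)
qed

section \<open>The surplus of an orientation\<close>

abbreviation indegree :: "('v, 'e) wgraph \<Rightarrow> ('e \<times> bool) set \<Rightarrow> 'v \<Rightarrow> int" where
  "indegree G T v \<equiv> int (card {h \<in> T. half_end G h = v})"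

lemma sum_card_fibres:
  assumes "finite A" "finite Z"
  shows "(\<Sum>v \<in> Z. int (card {x \<in> A. f x = v})) = int (card {x \<in> A. f x \<in> Z})"
proof -
  have "{x \<in> A. f x \<in> Z} = (\<Union>v \<in> Z. {x \<in> A. f x = v})"
    by auto
  then have "card {x \<in> A. f x \<in> Z} = (\<Sum>v \<in> Z. card {x \<in> A. f x = v})"
    using assms by (simp only:) (intro card_UN_disjoint, auto)
  then show ?thesis by simp
qed

lemma card_bool_Collect: "card {i. P i} = of_bool (P True) + of_bool (P False)"
proof -
  have "{i. P i} = (if P True then {True} else {}) \<union> (if P False then {False} else {})"
    by (auto split: if_splits) (metis (full_types))+
  then show ?thesis by simp
qed

lemma finite_gen_orientation: "weighted_graph G \<Longrightarrow> gen_orientation G T \<Longrightarrow> finite T"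
  unfolding gen_orientation_def half_edges_def by (auto intro: finite_subset)

text \<open>Counts the targets lying in \<open>Z\<close> edge by edge. An edge inside
  \<open>Z\<close> contributes one, which the surplus subtracts again, and a second one if
  bioriented; a cut edge contributes one exactly if it has a target in \<open>Z\<close>.\<close>

lemma surplus_indegree:
  assumes G: "weighted_graph G" and T: "gen_orientation G T" and Z: "Z \<subseteq> verts G"
  shows "surplus G (indegree G T) Z = int (card (bioriented G T \<inter> edges (induced G Z)))
    + int (card {e \<in> cut G Z. has_target_in G T e Z})"
proof -
  have fin: "finite Z" "finite T"
    using G Z finite_subset finite_verts finite_gen_orientation[OF G T] by blast+
  have "{h \<in> T. half_end G h \<in> Z} = (SIGMA e : edges G. {i. (e, i) \<in> T \<and> half_end G (e, i) \<in> Z})"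
    using T by (auto simp: gen_orientation_def half_edges_def)
  then have "card {h \<in> T. half_end G h \<in> Z} =
      (\<Sum>e \<in> edges G. card {i. (e, i) \<in> T \<and> half_end G (e, i) \<in> Z})"
    using G by simp
  also have "\<dots> = (\<Sum>e \<in> edges G. of_bool (e \<in> edges (induced G Z))
      + of_bool (e \<in> bioriented G T \<inter> edges (induced G Z))
      + of_bool (e \<in> cut G Z \<and> has_target_in G T e Z))"
  proof (rule sum.cong)
    fix e assume e: "e \<in> edges G"
    have "(e, True) \<in> T \<or> (e, False) \<in> T"
      using T e unfolding gen_orientation_def by (metis (full_types))
    then show "card {i. (e, i) \<in> T \<and> half_end G (e, i) \<in> Z} = of_bool (e \<in> edges (induced G Z))
        + of_bool (e \<in> bioriented G T \<inter> edges (induced G Z))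
        + of_bool (e \<in> cut G Z \<and> has_target_in G T e Z)"
      using e half_end_in_verts[OF G e]
      by (auto simp: card_bool_Collect bioriented_def cut_def has_target_in_def all_bool_eq ex_bool_eq)
  qed simp
  also have "\<dots> = card (edges (induced G Z)) + card (bioriented G T \<inter> edges (induced G Z))
      + card {e \<in> cut G Z. has_target_in G T e Z}"
  proof -
    have "edges G \<inter> {e. e \<in> edges (induced G Z)} = edges (induced G Z)"
      "edges G \<inter> {e. e \<in> bioriented G T \<inter> edges (induced G Z)} = bioriented G T \<inter> edges (induced G Z)"
      "edges G \<inter> {e. e \<in> cut G Z \<and> has_target_in G T e Z} = {e \<in> cut G Z. has_target_in G T e Z}"
      by (auto simp: bioriented_def cut_def)
    then show ?thesis
      using G by (simp only: sum.distrib sum_of_bool_eq finite_edges of_nat_id)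
  qed
  finally show ?thesis
    by (simp add: surplus_def sum_card_fibres[OF fin(2,1)] del: induced_simps)
qed

lemma edge_position:
  assumes "weighted_graph G" "Z \<subseteq> verts G" "e \<in> edges G"
  obtains "e \<in> edges (induced G Z)" | "e \<in> cut G Z" | "e \<in> edges (induced G (verts G - Z))"
  using half_end_in_verts[OF assms(1,3)] assms(3) that
  by (auto simp: cut_def all_bool_eq ex_bool_eq)

lemma cut_complement: "Z \<subseteq> verts G \<Longrightarrow> cut G (verts G - Z) = cut G Z"
  by (auto simp: cut_def ex_bool_eq)

lemma cut_verts [simp]: "cut G (verts G) = {}"
  by (auto simp: cut_def)

section \<open>Orientations with prescribed indegrees\<close>

text \<open>The edge \<open>e\<close> lies inside the union but inside neither set, so the count of
  induced edges is strictly supermodular here, while the sum of \<open>t\<close> is modular.\<close>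

lemma surplus_strict_submodular:
  assumes G: "weighted_graph G" and "A \<subseteq> verts G" "B \<subseteq> verts G" and e: "e \<in> edges G"
    and "half_end G (e, i) \<in> A - B" "half_end G (e, \<not> i) \<in> B - A"
  shows "surplus G t (A \<union> B) + surplus G t (A \<inter> B) < surplus G t A + surplus G t B"
proof -
  have fin: "finite A" "finite B"
    using assms finite_subset finite_verts by blast+
  let ?E = "\<lambda>Z. edges (induced G Z)"
  have ends: "half_end G (e, j) \<in> A \<union> B" for j
    using assms(5,6) by (cases "j = i") auto
  have "insert e (?E A \<union> ?E B) \<subseteq> ?E (A \<union> B)"
    using ends e by auto
  moreover have "e \<notin> ?E A \<union> ?E B"
    using assms(5,6) by auto
  ultimately have "card (?E A \<union> ?E B) < card (?E (A \<union> B))"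
    using G by (intro psubset_card_mono) auto
  moreover have "?E (A \<inter> B) = ?E A \<inter> ?E B"
    by auto
  then have "card (?E A) + card (?E B) = card (?E A \<union> ?E B) + card (?E (A \<inter> B))"
    using card_Un_Int[of "?E A" "?E B"] G by simp
  moreover have "(\<Sum>v \<in> A \<union> B. t v) + (\<Sum>v \<in> A \<inter> B. t v) = (\<Sum>v \<in> A. t v) + (\<Sum>v \<in> B. t v)"
    using fin by (rule sum.union_inter)
  ultimately show ?thesis
    unfolding surplus_def by linarith
qed

text \<open>Here \<open>A\<close> is the set of half-edges of \<open>e\<close> chosen as targets: a
  singleton for a directed edge, \<open>UNIV\<close> for a bioriented one. The last term appears
  because \<open>e\<close> no longer counts among the edges inside \<open>Z\<close>.\<close>

lemma surplus_del_edge: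
  assumes G: "weighted_graph G" and Z: "Z \<subseteq> verts G" and e: "e \<in> edges G"
  shows "surplus (del_edges G {e}) (\<lambda>v. t v - int (card {i \<in> A. half_end G (e, i) = v})) Z =
    surplus G t Z - int (card {i \<in> A. half_end G (e, i) \<in> Z}) + of_bool (\<forall>i. half_end G (e, i) \<in> Z)"
proof -
  have "finite Z"
    using G Z finite_subset finite_verts by blast
  moreover have "edges (induced (del_edges G {e}) Z) = edges (induced G Z) - {e}"
    by auto
  moreover have "int (card (edges (induced G Z) - {e})) =
      int (card (edges (induced G Z))) - of_bool (e \<in> edges (induced G Z))"
  proof (cases "e \<in> edges (induced G Z)")
    case True
    then have "card (edges (induced G Z)) > 0"
      using G by (auto simp: card_gt_0_iff)
    then show ?thesis
      using True by (simp add: card_Diff_singleton of_nat_diff del: induced_simps)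
  qed (simp del: induced_simps)
  ultimately show ?thesis
    using e by (simp add: surplus_def sum_subtractf sum_card_fibres)
qed

text \<open>The inverse of the deletion above: restoring \<open>e\<close> with targets
  \<open>A\<close> gives back the subtracted indegrees.\<close>

lemma add_edge_orientation:
  assumes G: "weighted_graph G" and e: "e \<in> edges G"
    and T: "gen_orientation (del_edges G {e}) T" and A: "A \<noteq> {}"
  shows gen_orientation_add_edge: "gen_orientation G (T \<union> {e} \<times> A)"
    and bioriented_add_edge:
      "bioriented G (T \<union> {e} \<times> A) = bioriented (del_edges G {e}) T \<union> (if A = UNIV then {e} else {})"
    and indegree_add_edge:
      "indegree G (T \<union> {e} \<times> A) v = indegree G T v + int (card {i \<in> A. half_end G (e, i) = v})"
proof -
  have noe: "(e, i) \<notin> T" for i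
    using T by (auto simp: gen_orientation_def half_edges_def)
  show "gen_orientation G (T \<union> {e} \<times> A)"
    using T e A unfolding gen_orientation_def half_edges_def by auto
  show "bioriented G (T \<union> {e} \<times> A) = bioriented (del_edges G {e}) T \<union> (if A = UNIV then {e} else {})"
    using noe e by (auto simp: bioriented_def)
  have "{h \<in> T \<union> {e} \<times> A. half_end G h = v} =
      {h \<in> T. half_end G h = v} \<union> Pair e ` {i \<in> A. half_end G (e, i) = v}"
    by auto
  moreover have "finite T"
    using finite_gen_orientation[OF weighted_graph_del_edges[OF G] T] .
  moreover have "{h \<in> T. half_end G h = v} \<inter> Pair e ` {i \<in> A. half_end G (e, i) = v} = {}"
    using noe by auto
  ultimately show "indegree G (T \<union> {e} \<times> A) v =
      indegree G T v + int (card {i \<in> A. half_end G (e, i) = v})"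
    by (simp add: card_Un_disjoint card_image inj_on_def)
qed

text \<open>Hakimi's theorem. An edge can be directed towards one of its ends unless some set
  of surplus zero contains only that end; such sets for both ends would contradict
  strict submodularity.\<close>

lemma orientation_with_indegrees:
  assumes "weighted_graph G" "surplus G t (verts G) = 0"
    and "\<And>Z. Z \<subseteq> verts G \<Longrightarrow> 0 \<le> surplus G t Z"
  shows "\<exists>T. gen_orientation G T \<and> bioriented G T = {} \<and> (\<forall>v \<in> verts G. indegree G T v = t v)"
  using assms
proof (induction "card (edges G)" arbitrary: G t)
  case 0
  then have E: "edges G = {}"
    by simp
  \<comment> \<open>Without edges the surplus of a singleton is the value of \<open>t\<close>;
    nonnegative values with sum zero all vanish.\<close>
  have "0 \<le> t v" if "v \<in> verts G" for v
    using "0.prems"(3)[of "{v}"] that E by (simp add: surplus_def)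
  moreover have "(\<Sum>v \<in> verts G. t v) = 0"
    using "0.prems"(2) E by (simp add: surplus_def)
  ultimately have "\<forall>v \<in> verts G. t v = 0"
    using sum_nonneg_eq_0_iff[of "verts G" t] "0.prems"(1) by simp
  then show ?case
    using E by (intro exI[of _ "{}"]) (simp add: gen_orientation_def bioriented_def)
next
  case (Suc n)
  note G = Suc.prems(1)
  obtain e where e: "e \<in> edges G"
    using Suc.hyps(2) by fastforce
  define tight where "tight i Z \<longleftrightarrow> Z \<subseteq> verts G \<and> surplus G t Z = 0 \<and>
    half_end G (e, i) \<in> Z \<and> half_end G (e, \<not> i) \<notin> Z" for i Z
  have "\<not> tight True A \<or> \<not> tight False B" for A B
  proof (rule ccontr)
    assume "\<not> (\<not> tight True A \<or> \<not> tight False B)"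
    then have AB: "tight True A" "tight False B" by auto
    then have "surplus G t (A \<union> B) + surplus G t (A \<inter> B) < surplus G t A + surplus G t B"
      by (intro surplus_strict_submodular[OF G _ _ e, of _ _ True]) (auto simp: tight_def)
    moreover have "0 \<le> surplus G t (A \<union> B)" "0 \<le> surplus G t (A \<inter> B)"
      using AB by (auto simp: tight_def intro!: Suc.prems(3))
    ultimately show False
      using AB by (simp add: tight_def)
  qed
  then obtain i where i: "\<And>Z. \<not> tight i Z"
    by blast
  \<comment> \<open>The edge \<open>e\<close> will have target half-edge \<open>i\<close>, so its
    end needs one target fewer from the remaining edges.\<close>
  define t' where "t' = (\<lambda>v. t v - int (card {j \<in> {i}. half_end G (e, j) = v}))"
  have t': "surplus (del_edges G {e}) t' Z =
      surplus G t Z - of_bool (half_end G (e, i) \<in> Z \<and> half_end G (e, \<not> i) \<notin> Z)"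
    if "Z \<subseteq> verts G" for Z
  proof -
    have "{j \<in> {i}. half_end G (e, j) \<in> Z} = (if half_end G (e, i) \<in> Z then {i} else {})"
      by (simp add: Collect_conv_if)
    moreover have "(\<forall>j. half_end G (e, j) \<in> Z) \<longleftrightarrow> half_end G (e, i) \<in> Z \<and> half_end G (e, \<not> i) \<in> Z"
      by (cases i) (auto simp: all_bool_eq)
    ultimately show ?thesis
      unfolding t'_def surplus_del_edge[OF G that e] by simp
  qed
  \<comment> \<open>The surplus drops, by one, only on sets containing the end \<open>i\<close> of
    \<open>e\<close> but not the other; no such set is tight, so it had surplus at least
    one.\<close>
  have "0 \<le> surplus (del_edges G {e}) t' Z" if "Z \<subseteq> verts (del_edges G {e})" for Z
    using t'[of Z] Suc.prems(3)[of Z] i[of Z] that unfolding tight_def by auto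
  moreover have "surplus (del_edges G {e}) t' (verts (del_edges G {e})) = 0"
    using t'[of "verts G"] Suc.prems(2) half_end_in_verts[OF G e] by simp
  moreover have "n = card (edges (del_edges G {e}))"
    using Suc.hyps(2) e by simp
  ultimately have "\<exists>T. gen_orientation (del_edges G {e}) T \<and> bioriented (del_edges G {e}) T = {} \<and>
      (\<forall>v \<in> verts (del_edges G {e}). indegree (del_edges G {e}) T v = t' v)"
    by (intro Suc.hyps(1) weighted_graph_del_edges[OF G])
  then obtain T where T: "gen_orientation (del_edges G {e}) T"
      "bioriented (del_edges G {e}) T = {}" "\<forall>v \<in> verts G. indegree G T v = t' v"
    by auto
  have "{i} \<noteq> UNIV"
    by (cases i) auto
  then show ?case
    using add_edge_orientation[OF G e T(1), of "{i}"] T(2,3)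
    by (intro exI[of _ "T \<union> {e} \<times> {i}"]) (simp add: t'_def)
qed

section \<open>Stable divisors and orientations\<close>

text \<open>The case left out is an edgeless graph with b = 1, where the divisor contains b by
  convention instead of a number of targets.\<close>

lemma target_degrees_orientation_divisor:
  assumes "gen_orientation G T" "edges G \<noteq> {} \<or> b = 0" "v \<in> verts G"
  shows "target_degrees G (orientation_divisor b G T) v = indegree G T v"
proof (cases "edges G = {}")
  case True
  then have "T = {}"
    using assms(1) by (simp add: gen_orientation_def half_edges_def)
  then show ?thesis
    using assms True by (simp add: target_degrees_def orientation_divisor_def)
qed (use assms in \<open>simp add: target_degrees_def orientation_divisor_def\<close>)

lemma surplus_orientation_divisor:
  assumes "gen_orientation G T" "edges G \<noteq> {} \<or> b = 0" "Z \<subseteq> verts G"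
  shows "surplus G (target_degrees G (orientation_divisor b G T)) Z = surplus G (indegree G T) Z"
  using assms(3) target_degrees_orientation_divisor[OF assms(1,2)]
  by (intro surplus_cong) auto

lemma orientation_divisor_in_divisors [simp]: "orientation_divisor b G T \<in> divisors G"
  by (simp add: orientation_divisor_def divisors_def)

lemma orientation_divisor_eqI:
  assumes "gen_orientation G T" "edges G \<noteq> {} \<or> b = 0" "d \<in> divisors G"
    and "\<forall>v \<in> verts G. indegree G T v = target_degrees G d v"
  shows "orientation_divisor b G T = d"
proof
  fix v
  show "orientation_divisor b G T v = d v"
  proof (cases "v \<in> verts G")
    case True
    then show ?thesis
      using target_degrees_orientation_divisor[OF assms(1,2) True] assms(4)
      by (simp add: target_degrees_def)
  next
    case False
    then show ?thesis
      using assms(3) by (auto simp: orientation_divisor_def divisors_def PiE_def extensional_def)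
  qed
qed

text \<open>Yields part (b) and one inclusion of part (a) for b = 0. Passing to the complement keeps
  the cut and exchanges the two demands of total cyclicity, so a target in \<open>Z\<close> for
  every nonempty cut suffices. The remaining conditions of stability hold because the surplus counts
  edges.\<close>

lemma orientations_0_iff:
  assumes G: "weighted_graph G"
  shows "T \<in> orientations 0 G \<longleftrightarrow>
    b_orientation 0 G T \<and> orientation_divisor 0 G T \<in> stable0 G"
proof (cases "b_orientation 0 G T")
  case True
  then have T: "gen_orientation G T" "bioriented G T = {}"
    using G by (auto simp: b_orientation_def bioriented_def)
  let ?p = "surplus G (target_degrees G (orientation_divisor 0 G T))"
  have p: "?p Z = int (card {e \<in> cut G Z. has_target_in G T e Z})" if "Z \<subseteq> verts G" for Z
    using surplus_orientation_divisor[OF T(1) _ that, of 0] surplus_indegree[OF G T(1) that] T(2)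
    by simp
  have fin: "finite (cut G Z)" for Z
    using G by (auto simp: cut_def)
  have pos: "1 \<le> ?p Z \<longleftrightarrow> (\<exists>e \<in> cut G Z. has_target_in G T e Z)" if "Z \<subseteq> verts G" for Z
  proof -
    have "1 \<le> ?p Z \<longleftrightarrow> 0 < card {e \<in> cut G Z. has_target_in G T e Z}"
      using p[OF that] by linarith
    then show ?thesis
      using fin[of Z] by (auto simp: card_gt_0_iff)
  qed
  have "totally_cyclic G T \<longleftrightarrow> (\<forall>Z \<subseteq> verts G. cut G Z \<noteq> {} \<longrightarrow> 1 \<le> ?p Z)" (is "?L \<longleftrightarrow> ?R")
  proof
    assume L: ?L
    show ?R
    proof (intro allI impI)
      fix Z assume Z: "Z \<subseteq> verts G" "cut G Z \<noteq> {}"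
      then have "Z \<noteq> {}" "Z \<noteq> verts G"
        by (auto simp: cut_def)
      then show "1 \<le> ?p Z"
        using L Z pos[OF Z(1)] unfolding totally_cyclic_def by blast
    qed
  next
    assume R: ?R
    show ?L
      unfolding totally_cyclic_def
    proof (intro allI impI)
      fix Z assume Z: "Z \<noteq> {} \<and> Z \<subset> verts G \<and> cut G Z \<noteq> {}"
      then have "1 \<le> ?p Z" "1 \<le> ?p (verts G - Z)"
        using R cut_complement[of Z G] by (simp_all add: psubset_imp_subset)
      then show "(\<exists>e \<in> cut G Z. has_target_in G T e Z) \<and>
          (\<exists>e \<in> cut G Z. has_target_in G T e (verts G - Z))"
        using pos[of Z] pos[of "verts G - Z"] cut_complement[of Z G] Z by auto
    qed
  qed
  moreover have "orientation_divisor 0 G T \<in> stable0 G \<longleftrightarrow>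
      (\<forall>Z \<subseteq> verts G. cut G Z \<noteq> {} \<longrightarrow> 1 \<le> ?p Z)"
    unfolding stable0_iff[OF G] using p by simp
  ultimately show ?thesis
    using True by (simp add: orientations_def)
qed (simp add: orientations_def)

lemma stable0_realised:
  assumes G: "weighted_graph G" and d: "d \<in> stable0 G"
  shows "\<exists>T. b_orientation 0 G T \<and> orientation_divisor 0 G T = d"
proof -
  have "d \<in> divisors G" "surplus G (target_degrees G d) (verts G) = 0"
      "\<And>Z. Z \<subseteq> verts G \<Longrightarrow> 0 \<le> surplus G (target_degrees G d) Z"
    using d unfolding stable0_iff[OF G] by auto
  then obtain T where T: "gen_orientation G T" "bioriented G T = {}"
      "\<forall>v \<in> verts G. indegree G T v = target_degrees G d v"
    using orientation_with_indegrees[OF G] by blast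
  then show ?thesis
    using orientation_divisor_eqI[OF T(1) _ \<open>d \<in> divisors G\<close> T(3), of 0]
    by (auto simp: b_orientation_def)
qed

section \<open>Rooted 1-orientations\<close>

lemma lone_vertex_divisor:
  assumes "weighted_graph G" "lone_vertex G"
  shows "orientation_divisor 1 G T \<in> stable1 G"
proof -
  obtain v where v: "verts G = {v}" "edges G = {}"
    using assms(2) by (auto simp: lone_vertex_def card_1_singleton_iff)
  have "connected_graph G"
    unfolding connected_graph_iff_cut[OF assms(1)] v by auto
  \<comment> \<open>The convention for edgeless graphs adds b = 1 to the divisor, and this is the
    required surplus.\<close>
  moreover have "surplus G (target_degrees G (orientation_divisor 1 G T)) {v} = 1"
    using v by (simp add: surplus_def target_degrees_def orientation_divisor_def)
  ultimately show ?thesis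
    unfolding stable1_iff[OF assms(1)] v(1) subset_singleton_iff by fastforce
qed

lemma b_orientation_1_cases:
  assumes "b_orientation 1 G T"
  obtains "lone_vertex G" | e where "edges G \<noteq> {}" "\<not> lone_vertex G" "bioriented G T = {e}"
  using assms by (auto simp: b_orientation_def card_1_singleton_iff bioriented_def lone_vertex_def)

text \<open>Rootedness at a set containing \<open>e\<close> is positivity of the surplus of its
  complement. All other nonempty sets are positive anyway: \<open>e\<close> either lies inside or
  crosses the cut, and then has a target on both sides.\<close>

lemma rooted_iff_surplus:
  assumes G: "weighted_graph G" and T: "gen_orientation G T" "bioriented G T = {e}"
  shows "rooted G T \<longleftrightarrow> (\<forall>Z. Z \<noteq> {} \<and> Z \<subseteq> verts G \<longrightarrow> 1 \<le> surplus G (indegree G T) Z)"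
    (is "_ \<longleftrightarrow> ?R")
proof -
  have e: "e \<in> edges G" "\<And>i. (e, i) \<in> T"
    using T(2) by (auto simp: bioriented_def)
  have fin: "finite (cut G Z)" for Z
    using G by (auto simp: cut_def)
  have pos: "1 \<le> surplus G (indegree G T) Z \<longleftrightarrow>
      e \<in> edges (induced G Z) \<or> (\<exists>f \<in> cut G Z. has_target_in G T f Z)" if "Z \<subseteq> verts G" for Z
  proof -
    have "surplus G (indegree G T) Z = of_bool (e \<in> edges (induced G Z))
        + int (card {f \<in> cut G Z. has_target_in G T f Z})"
      unfolding surplus_indegree[OF G T(1) that] T(2) by (simp del: induced_simps)
    moreover have "0 < card {f \<in> cut G Z. has_target_in G T f Z} \<longleftrightarrow>
        (\<exists>f \<in> cut G Z. has_target_in G T f Z)"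
      using fin[of Z] by (auto simp: card_gt_0_iff)
    ultimately show ?thesis
      by (cases "e \<in> edges (induced G Z)") (simp_all del: induced_simps, linarith)
  qed
  show ?thesis
  proof
    assume "rooted G T"
    then have L: "\<exists>f \<in> cut G Z. has_target_in G T f (verts G - Z)"
      if "Z \<subset> verts G" "e \<in> edges (induced G Z)" for Z
      using that T(2) by (auto simp: rooted_def simp del: induced_simps)
    show ?R
    proof (intro allI impI)
      fix Z assume Z: "Z \<noteq> {} \<and> Z \<subseteq> verts G"
      then have sub: "Z \<subseteq> verts G" by simp
      show "1 \<le> surplus G (indegree G T) Z"
        using G sub e(1)
      proof (cases rule: edge_position)
        case 1
        then show ?thesis using pos[OF sub] by simp
      next
        case 2
        then have "has_target_in G T e Z"
          using e by (auto simp: cut_def has_target_in_def)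
        then show ?thesis using 2 pos[OF sub] by blast
      next
        case 3
        \<comment> \<open>With \<open>e\<close> inside the complement, rootedness is applied to the
          complement and gives a cut edge with target in \<open>Z\<close>.\<close>
        have "verts G - Z \<subset> verts G" using Z by blast
        from L[OF this 3] show ?thesis
          using pos[OF sub] cut_complement[OF sub] sub by (simp add: double_diff)
      qed
    qed
  next
    assume R: ?R
    have "\<exists>f \<in> cut G Z. has_target_in G T f (verts G - Z)"
      if Z: "Z \<subset> verts G" "e \<in> edges (induced G Z)" for Z
    proof -
      have "1 \<le> surplus G (indegree G T) (verts G - Z)"
      proof -
        have "verts G - Z \<noteq> {}" "verts G - Z \<subseteq> verts G"
          using Z(1) by blast+
        then show ?thesis using R by simp
      qed
      moreover have "e \<notin> edges (induced G (verts G - Z))"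
        using Z(2) by simp
      moreover have "cut G (verts G - Z) = cut G Z"
        using Z(1) by (intro cut_complement) blast
      ultimately show ?thesis
        using pos[OF Diff_subset, of Z] by metis
    qed
    then show "rooted G T"
      unfolding rooted_def using T(2) by blast
  qed
qed

text \<open>Either \<open>e\<close> itself crosses the cut, or it lies on one side and rootedness at
  that side provides a cut edge.\<close>

lemma rooted_connected:
  assumes G: "weighted_graph G" and T: "rooted G T"
  shows "connected_graph G"
proof -
  obtain e where "bioriented G T = {e}"
      and r: "\<And>Z. Z \<subset> verts G \<Longrightarrow> e \<in> edges (induced G Z) \<Longrightarrow> cut G Z \<noteq> {}"
    using T unfolding rooted_def by (metis empty_iff)
  then have e: "e \<in> edges G"
    by (auto simp: bioriented_def)
  have "cut G Z \<noteq> {}" if Z: "Z \<noteq> {}" "Z \<subset> verts G" for Z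
    using G psubset_imp_subset[OF Z(2)] e
  proof (cases rule: edge_position)
    case 3
    have "verts G - Z \<subset> verts G" using Z by blast
    from r[OF this 3] show ?thesis
      using cut_complement[of Z G] Z(2) by auto
  qed (use r Z in auto)
  then show ?thesis
    using connected_graph_iff_cut[OF G] half_end_in_verts[OF G e] by blast
qed

text \<open>For a lone vertex both sides reduce to being a 1-orientation. Otherwise the total
  surplus is 1 because of the bioriented edge, and the connectedness contained in stability follows
  from rootedness.\<close>

lemma orientations_1_iff:
  assumes G: "weighted_graph G"
  shows "T \<in> orientations 1 G \<longleftrightarrow>
    b_orientation 1 G T \<and> orientation_divisor 1 G T \<in> stable1 G"
proof (cases "b_orientation 1 G T")
  case True
  then show ?thesis
  proof (cases rule: b_orientation_1_cases)
    case 1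
    then show ?thesis
      using lone_vertex_divisor[OF G 1] by (simp add: orientations_def)
  next
    case (2 e)
    have T: "gen_orientation G T"
      using True by (simp add: b_orientation_def)
    have "bioriented G T \<inter> edges G = {e}"
      using 2(3) by (auto simp: bioriented_def)
    then have "surplus G (indegree G T) (verts G) = 1"
      using surplus_indegree[OF G T subset_refl] induced_verts[OF G] by (simp del: induced_simps)
    moreover have "surplus G (target_degrees G (orientation_divisor 1 G T)) Z =
        surplus G (indegree G T) Z" if "Z \<subseteq> verts G" for Z
      using surplus_orientation_divisor[OF T _ that] 2(1) by blast
    ultimately have "orientation_divisor 1 G T \<in> stable1 G \<longleftrightarrow> connected_graph G \<and> rooted G T"
      unfolding stable1_iff[OF G] rooted_iff_surplus[OF G T 2(3)] by simp
    then show ?thesis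
      using True 2(2) rooted_connected[OF G, of T] by (auto simp: orientations_def)
  qed
qed (simp add: orientations_def)

lemma stable1_realised:
  assumes G: "weighted_graph G" and d: "d \<in> stable1 G"
  shows "\<exists>T. b_orientation 1 G T \<and> orientation_divisor 1 G T = d"
proof (cases "edges G = {}")
  case True
  have conn: "connected_graph G" and p: "surplus G (target_degrees G d) (verts G) = 1"
    and div: "d \<in> divisors G"
    using d unfolding stable1_iff[OF G] by auto
  obtain v where "v \<in> verts G"
    using conn by (auto simp: connected_graph_def)
  moreover have "cut G {v} = {}"
    using True by (auto simp: cut_def)
  \<comment> \<open>A connected graph without edges is a single vertex, and the empty orientation is
    the only candidate.\<close>
  ultimately have v: "verts G = {v}"
    using conn unfolding connected_graph_iff_cut[OF G] by blast
  then have "b_orientation 1 G {}"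
    using True by (simp add: b_orientation_def gen_orientation_def lone_vertex_def)
  moreover have "orientation_divisor 1 G {} = d"
  proof
    fix u
    show "orientation_divisor 1 G {} u = d u"
      using p div True v
      by (auto simp: orientation_divisor_def surplus_def target_degrees_def divisors_def
          PiE_def extensional_def)
  qed
  ultimately show ?thesis by blast
next
  case False
  then obtain e where e: "e \<in> edges G" by blast
  have p: "surplus G (target_degrees G d) (verts G) = 1"
      "\<And>Z. Z \<noteq> {} \<Longrightarrow> Z \<subseteq> verts G \<Longrightarrow> 1 \<le> surplus G (target_degrees G d) Z"
      and div: "d \<in> divisors G"
    using d unfolding stable1_iff[OF G] by auto
  define t where "t = (\<lambda>v. target_degrees G d v - int (card {i \<in> UNIV. half_end G (e, i) = v}))"
  \<comment> \<open>Inside \<open>Z\<close> the edge takes away two targets but also one edge;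
    across the cut it takes away one target. Either way the surplus drops by one, exactly when
    \<open>e\<close> meets \<open>Z\<close>.\<close>
  have t: "surplus (del_edges G {e}) t Z = surplus G (target_degrees G d) Z
      - of_bool (half_end G (e, True) \<in> Z \<or> half_end G (e, False) \<in> Z)"
    if "Z \<subseteq> verts G" for Z
    unfolding t_def surplus_del_edge[OF G that e]
    by (auto simp: card_bool_Collect all_bool_eq)
  \<comment> \<open>A drop by one is harmless, since every nonempty set has surplus at least one by
    stability.\<close>
  have "0 \<le> surplus (del_edges G {e}) t Z" if "Z \<subseteq> verts G" for Z
    using t[OF that] p(2)[OF _ that] by (cases "Z = {}") (auto simp: of_bool_def)
  moreover have "surplus (del_edges G {e}) t (verts G) = 0"
    using t[OF subset_refl] p(1) half_end_in_verts[OF G e] by simp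
  ultimately obtain T where T: "gen_orientation (del_edges G {e}) T"
      "bioriented (del_edges G {e}) T = {}" "\<forall>v \<in> verts G. indegree G T v = t v"
    using orientation_with_indegrees[OF weighted_graph_del_edges[OF G], of "{e}" t] by auto
  let ?T = "T \<union> {e} \<times> UNIV"
  have T': "gen_orientation G ?T" "bioriented G ?T = {e}"
      "\<forall>v \<in> verts G. indegree G ?T v = target_degrees G d v"
    using add_edge_orientation[OF G e T(1), of UNIV] T(2,3) by (simp_all add: t_def)
  then show ?thesis
    using orientation_divisor_eqI[OF T'(1) _ div T'(3), of 1] False
    by (intro exI[of _ ?T]) (simp add: b_orientation_def)
qed

section \<open>Both values of b together, and the passage to classes\<close>

lemma orientations_iff:
  assumes "weighted_graph G" "b \<in> {0, 1}"
  shows "T \<in> orientations b G \<longleftrightarrow>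
    b_orientation b G T \<and> orientation_divisor b G T \<in> stable_divisors b G"
  using assms orientations_0_iff orientations_1_iff by (auto simp: stable_divisors_def)

lemma orientation_divisor_image:
  assumes "weighted_graph G" "b \<in> {0, 1}"
  shows "orientation_divisor b G ` orientations b G = stable_divisors b G"
proof (intro equalityI subsetI)
  fix d assume "d \<in> stable_divisors b G"
  then have "\<exists>T. b_orientation b G T \<and> orientation_divisor b G T = d"
    using assms stable0_realised stable1_realised by (auto simp: stable_divisors_def)
  then show "d \<in> orientation_divisor b G ` orientations b G"
    using \<open>d \<in> stable_divisors b G\<close> orientations_iff[OF assms] by blast
qed (use orientations_iff[OF assms] in auto)

lemma totally_cyclic_bridgeless:
  assumes T: "T \<in> orientations 0 G" and G: "weighted_graph G"
  shows "bridgeless G"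
proof -
  have False if Z: "Z \<noteq> {}" "Z \<subset> verts G" "cut G Z = {e}" for Z e
  proof -
    have "totally_cyclic G T"
      using T by (simp add: orientations_def)
    then have "(\<exists>f \<in> cut G Z. has_target_in G T f Z) \<and>
        (\<exists>f \<in> cut G Z. has_target_in G T f (verts G - Z))"
      unfolding totally_cyclic_def using Z by (metis insert_not_empty)
    then have "has_target_in G T e Z" "has_target_in G T e (verts G - Z)"
      using Z(3) by simp_all
    \<comment> \<open>The two targets lie in disjoint vertex sets, so they are different
      half-edges.\<close>
    then have "(e, True) \<in> T \<and> (e, False) \<in> T"
      unfolding has_target_in_def by (metis (full_types) DiffD2)
    then have "(e, i) \<in> T" for i
      by (cases i) simp_all
    moreover have "e \<in> edges G"
      using Z(3) by (auto simp: cut_def)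
    ultimately have "e \<in> bioriented G T"
      by (simp add: bioriented_def)
    moreover have "finite (bioriented G T)"
      using G by (simp add: bioriented_def)
    ultimately show False
      using T by (auto simp: orientations_def b_orientation_def)
  qed
  then show ?thesis
    unfolding bridgeless_def bridge_def by blast
qed

lemma orientations_1_connected:
  "T \<in> orientations 1 G \<Longrightarrow> weighted_graph G \<Longrightarrow> connected_graph G"
  using orientations_1_iff stable1_iff by blast

lemma divisor_of_class:
  assumes "T \<in> orientations b (del_edges G S)"
  shows "OP_divisor b G (S, orientation_equiv b (del_edges G S) `` {T}) =
    orientation_divisor b (del_edges G S) T"
proof -
  have "orientation_divisor b (del_edges G S) ` (orientation_equiv b (del_edges G S) `` {T}) =
      {orientation_divisor b (del_edges G S) T}"
    using assms by (auto simp: orientation_equiv_def)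
  then show ?thesis
    by (simp add: OP_divisor_def)
qed

lemma orientation_classes_cases:
  assumes "C \<in> orientation_classes b G"
  obtains T where "T \<in> orientations b G" "C = orientation_equiv b G `` {T}"
  using assms unfolding orientation_classes_def by (elim quotientE)

text \<open>The equivalence is the kernel of the divisor map on orientations, so the map induced on
  classes is a bijection onto the image.\<close>

lemma bij_betw_orientation_classes:
  "bij_betw (\<lambda>C. OP_divisor b G (S, C)) (orientation_classes b (del_edges G S))
    (orientation_divisor b (del_edges G S) ` orientations b (del_edges G S))"
  unfolding bij_betw_def
proof
  show "inj_on (\<lambda>C. OP_divisor b G (S, C)) (orientation_classes b (del_edges G S))"
  proof (rule inj_onI)
    fix C D
    assume "C \<in> orientation_classes b (del_edges G S)" "D \<in> orientation_classes b (del_edges G S)"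
      and eq: "OP_divisor b G (S, C) = OP_divisor b G (S, D)"
    then obtain T U where TU: "T \<in> orientations b (del_edges G S)" "U \<in> orientations b (del_edges G S)"
      and CD: "C = orientation_equiv b (del_edges G S) `` {T}"
        "D = orientation_equiv b (del_edges G S) `` {U}"
      by (meson orientation_classes_cases)
    have "orientation_divisor b (del_edges G S) T = orientation_divisor b (del_edges G S) U"
      using eq by (simp add: CD divisor_of_class TU)
    then show "C = D"
      using TU by (simp add: CD orientation_equiv_def)
  qed
  show "(\<lambda>C. OP_divisor b G (S, C)) ` orientation_classes b (del_edges G S) =
      orientation_divisor b (del_edges G S) ` orientations b (del_edges G S)"
  proof (intro equalityI subsetI)
    fix d assume "d \<in> orientation_divisor b (del_edges G S) ` orientations b (del_edges G S)"
    then obtain T where T: "T \<in> orientations b (del_edges G S)"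
        "d = orientation_divisor b (del_edges G S) T"
      by blast
    then have "orientation_equiv b (del_edges G S) `` {T} \<in> orientation_classes b (del_edges G S)"
      unfolding orientation_classes_def by (intro quotientI)
    then show "d \<in> (\<lambda>C. OP_divisor b G (S, C)) ` orientation_classes b (del_edges G S)"
      using divisor_of_class[OF T(1)] T(2) by force
  qed (auto elim!: orientation_classes_cases simp: divisor_of_class)
qed

theorem lemma3p3p2:
  fixes G :: "('v, 'e) wgraph" and b :: nat and g :: int and S :: "'e set"
  assumes "b \<in> {0, 1}"
    and "weighted_graph G" and "genus G = g"
    and "S \<subseteq> edges G"
  shows "OP_divisor b G \<in> OP_classes b G \<rightarrow> divisors G
    \<and> {S} \<times> orientation_classes b (del_edges G S) \<subseteq> OP_classes b G
    \<and> (\<forall>T \<in> orientations b (del_edges G S).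
         OP_divisor b G (S, orientation_equiv b (del_edges G S) `` {T})
           = orientation_divisor b (del_edges G S) T)
    \<and> bij_betw (\<lambda>C. OP_divisor b G (S, C))
        (orientation_classes b (del_edges G S)) (stable_divisors b (del_edges G S))
    \<and> (\<forall>T. b_orientation b (del_edges G S) T \<and>
           orientation_divisor b (del_edges G S) T \<in> stable_divisors b (del_edges G S)
         \<longrightarrow> T \<in> orientations b (del_edges G S))"
proof (intro conjI)
  let ?H = "del_edges G S"
  have H: "weighted_graph ?H"
    using assms(2) by (rule weighted_graph_del_edges)
  have "divisors (del_edges G R) = divisors G" for R
    by (simp add: divisors_def)
  then show "OP_divisor b G \<in> OP_classes b G \<rightarrow> divisors G"
    using orientation_divisor_in_divisors[of b "del_edges G _"]
    by (auto simp: OP_classes_def divisor_of_class elim!: orientation_classes_cases)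
  \<comment> \<open>Any class has a representative, whose existence forces the graph without
    \<open>S\<close> to be bridgeless, respectively connected.\<close>
  show "{S} \<times> orientation_classes b ?H \<subseteq> OP_classes b G"
    using assms(1,4) totally_cyclic_bridgeless[OF _ H] orientations_1_connected[OF _ H]
    by (auto simp: OP_classes_def elim: orientation_classes_cases)
  show "\<forall>T \<in> orientations b ?H.
      OP_divisor b G (S, orientation_equiv b ?H `` {T}) = orientation_divisor b ?H T"
    by (simp add: divisor_of_class)
  show "bij_betw (\<lambda>C. OP_divisor b G (S, C)) (orientation_classes b ?H) (stable_divisors b ?H)"
    using bij_betw_orientation_classes orientation_divisor_image[OF H assms(1)] by metis
  show "\<forall>T. b_orientation b ?H T \<and> orientation_divisor b ?H T \<in> stable_divisors b ?H
      \<longrightarrow> T \<in> orientations b ?H"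
    using orientations_iff[OF H assms(1)] by blast
qed

end
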